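(* Let $(W,S)$ be a finite Coxeter system with identity $e$ and Bruhat order $\le$. For $v\in W$ define the Bruhat size $|v|=R_{ev}(2)$ (i.e. the value at $q=1$ of the shifted polynomial $R_{ev}(q+1)$). Then: (1) if $u\le v$ then $|u|\le |v|$; (2) $|v|$ is odd for every $v\in W$.
   Context: The Kazhdan–Lusztig $R$-polynomials $R_{uw}(q)\in\mathbb{Z}[q]$ are the unique family with $R_{uw}=0$ if $u\not\le w$, $R_{uu}=1$, and, for $s\in S$ with $\ell(ws)<\ell(w)$ ($\ell$ the length function): $R_{uw}=R_{us,ws}$ if $\ell(us)<\ell(u)$, and $R_{uw}=(q-1)R_{u,ws}+qR_{us,ws}$ if $\ell(us)>\ell(u)$. *)

theory Defs
  imports
    "HOL-Algebra.Multiplicative_Group"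
    "HOL-Algebra.Generated_Groups"
    "HOL-Computational_Algebra.Polynomial"
begin

(* Group presentations: a word is a list of signed letters, where (x, True) stands for x
   and (x, False) for the formal inverse of x. *)

definition signed_words :: "'a set \<Rightarrow> ('a \<times> bool) list set" where
  "signed_words X = lists (X \<times> UNIV)"

(* Equality in the group with generators X and relators R, i.e. in the quotient of the
   free group on X by the normal closure of R. *)
inductive presented_eq ::
    "'a set \<Rightarrow> ('a \<times> bool) list set \<Rightarrow> ('a \<times> bool) list \<Rightarrow> ('a \<times> bool) list \<Rightarrow> bool"
  for X :: "'a set" and R :: "('a \<times> bool) list set" where
  refl: "a \<in> signed_words X \<Longrightarrow> presented_eq X R a a"
| sym: "presented_eq X R a b \<Longrightarrow> presented_eq X R b a"
| trans: "presented_eq X R a b \<Longrightarrow> presented_eq X R b c \<Longrightarrow> presented_eq X R a c"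
| cancel: "a \<in> signed_words X \<Longrightarrow> b \<in> signed_words X \<Longrightarrow> x \<in> X \<Longrightarrow>
    presented_eq X R (a @ [(x, \<epsilon>), (x, \<not> \<epsilon>)] @ b) (a @ b)"
| relator: "a \<in> signed_words X \<Longrightarrow> b \<in> signed_words X \<Longrightarrow> r \<in> R \<Longrightarrow>
    presented_eq X R (a @ r @ b) (a @ b)"

definition word_value :: "('a, 'b) monoid_scheme \<Rightarrow> ('a \<times> bool) list \<Rightarrow> 'a" where
  "word_value G ws =
     foldr (\<lambda>(x, \<epsilon>) y. (if \<epsilon> then x else inv\<^bsub>G\<^esub> x) \<otimes>\<^bsub>G\<^esub> y) ws \<one>\<^bsub>G\<^esub>"

definition group_presentation ::
    "('a, 'b) monoid_scheme \<Rightarrow> 'a set \<Rightarrow> ('a \<times> bool) list set \<Rightarrow> bool" where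
  "group_presentation G X R \<longleftrightarrow>
     group G \<and> X \<subseteq> carrier G \<and> R \<subseteq> signed_words X \<and> generate G X = carrier G \<and>
     (\<forall>a \<in> signed_words X. \<forall>b \<in> signed_words X.
        word_value G a = word_value G b \<longleftrightarrow> presented_eq X R a b)"

(* The relators (s t)^m(s,t), with m(s,t) the order of s t in W; the library's order function
   returns 0 for elements of infinite order, for which there is no relator. *)
definition coxeter_relators :: "('a, 'b) monoid_scheme \<Rightarrow> 'a set \<Rightarrow> ('a \<times> bool) list set" where
  "coxeter_relators W S =
     {concat (replicate (group.ord W (s \<otimes>\<^bsub>W\<^esub> t)) [(s, True), (t, True)]) | s t.
        s \<in> S \<and> t \<in> S \<and> group.ord W (s \<otimes>\<^bsub>W\<^esub> t) \<noteq> 0}"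

(* Bourbaki's definition: S consists of elements of order 2 and W is presented by S subject
   to the relations (s t)^m(s,t) = 1; the case s = t gives s^2 = 1. *)
definition coxeter_system :: "('a, 'b) monoid_scheme \<Rightarrow> 'a set \<Rightarrow> bool" where
  "coxeter_system W S \<longleftrightarrow>
     group W \<and> S \<subseteq> carrier W \<and> (\<forall>s \<in> S. group.ord W s = 2) \<and>
     group_presentation W S (coxeter_relators W S)"

definition cox_length :: "('a, 'b) monoid_scheme \<Rightarrow> 'a set \<Rightarrow> 'a \<Rightarrow> nat" where
  "cox_length W S w =
     (LEAST n. \<exists>ss. set ss \<subseteq> S \<and> length ss = n \<and> foldr (\<lambda>s x. s \<otimes>\<^bsub>W\<^esub> x) ss \<one>\<^bsub>W\<^esub> = w)"

definition cox_reflections :: "('a, 'b) monoid_scheme \<Rightarrow> 'a set \<Rightarrow> 'a set" where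
  "cox_reflections W S = {w \<otimes>\<^bsub>W\<^esub> s \<otimes>\<^bsub>W\<^esub> inv\<^bsub>W\<^esub> w | w s. w \<in> carrier W \<and> s \<in> S}"

definition bruhat_step :: "('a, 'b) monoid_scheme \<Rightarrow> 'a set \<Rightarrow> 'a \<Rightarrow> 'a \<Rightarrow> bool" where
  "bruhat_step W S u w \<longleftrightarrow>
     u \<in> carrier W \<and> (\<exists>t \<in> cox_reflections W S. w = u \<otimes>\<^bsub>W\<^esub> t) \<and>
     cox_length W S u < cox_length W S w"

definition bruhat_le :: "('a, 'b) monoid_scheme \<Rightarrow> 'a set \<Rightarrow> 'a \<Rightarrow> 'a \<Rightarrow> bool" where
  "bruhat_le W S u w \<longleftrightarrow> u \<in> carrier W \<and> w \<in> carrier W \<and> (bruhat_step W S)\<^sup>*\<^sup>* u w"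

(* The variable q is [:0, 1:].  Outside the carrier the family is fixed to be 0, as
   otherwise the defining properties would not determine it as a total function. *)
definition KL_R_family ::
    "('a, 'b) monoid_scheme \<Rightarrow> 'a set \<Rightarrow> ('a \<Rightarrow> 'a \<Rightarrow> int poly) \<Rightarrow> bool" where
  "KL_R_family W S R \<longleftrightarrow>
     (\<forall>u w. u \<notin> carrier W \<or> w \<notin> carrier W \<longrightarrow> R u w = 0) \<and>
     (\<forall>u \<in> carrier W. \<forall>w \<in> carrier W. \<not> bruhat_le W S u w \<longrightarrow> R u w = 0) \<and>
     (\<forall>u \<in> carrier W. R u u = 1) \<and>
     (\<forall>u \<in> carrier W. \<forall>w \<in> carrier W. \<forall>s \<in> S.
        cox_length W S (w \<otimes>\<^bsub>W\<^esub> s) < cox_length W S w \<longrightarrow>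
          (cox_length W S (u \<otimes>\<^bsub>W\<^esub> s) < cox_length W S u \<longrightarrow>
             R u w = R (u \<otimes>\<^bsub>W\<^esub> s) (w \<otimes>\<^bsub>W\<^esub> s)) \<and>
          (cox_length W S (u \<otimes>\<^bsub>W\<^esub> s) > cox_length W S u \<longrightarrow>
             R u w = ([:0, 1:] - 1) * R u (w \<otimes>\<^bsub>W\<^esub> s)
                     + [:0, 1:] * R (u \<otimes>\<^bsub>W\<^esub> s) (w \<otimes>\<^bsub>W\<^esub> s)))"

definition KL_R :: "('a, 'b) monoid_scheme \<Rightarrow> 'a set \<Rightarrow> 'a \<Rightarrow> 'a \<Rightarrow> int poly" where
  "KL_R W S = (THE R. KL_R_family W S R)"

definition bruhat_size :: "('a, 'b) monoid_scheme \<Rightarrow> 'a set \<Rightarrow> 'a \<Rightarrow> int" where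
  "bruhat_size W S v = poly (KL_R W S \<one>\<^bsub>W\<^esub> v) 2"

end

theory Submission
  imports Defs
begin

text \<open>
  At \<open>q = 2\<close> the recursion becomes \<open>R(x, w) = R(xs, ws)\<close> or \<open>R(x, w) = R(x, ws) + 2 R(xs, ws)\<close>,
  so all values are nonnegative, and modulo 2 the value \<open>R(e, w)\<close> never changes along a reduced word.

  Monotonicity holds for \<open>R(x, \<cdot>)\<close> with an arbitrary first argument \<open>x\<close>, by induction on the
  larger element \<open>v\<close>. Let \<open>u \<le> v\<close> and \<open>vs < v\<close>. By the lifting property, the induction
  hypothesis and the recursion settle every case but \<open>us > u\<close>, \<open>xs < x\<close>. There
  \<open>R(x, v) = R(xs, vs)\<close> and \<open>R(x, vs) \<ge> R(x, u)\<close>, so it suffices that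
  \<open>R(xs, w) \<ge> R(x, w)\<close> whenever \<open>xs < x\<close>. This inequality follows by induction on \<open>w\<close> from the
  recursion on the left side.

  The left recursion and the existence of the family come from commuting left and right Hecke
  operators on functions on \<open>W\<close>; the exchange condition comes from the parity of the number of
  times a reflection occurs as an inversion of a word.
\<close>

section \<open>Strong exchange\<close>

locale coxeter = group W for W :: "('a, 'b) monoid_scheme" (structure) +
  fixes S :: "'a set"
  assumes cox: "coxeter_system W S"
begin

abbreviation len :: "'a \<Rightarrow> nat" where "len \<equiv> cox_length W S"

section \<open>Words in the generators and cancellation rules\<close>

definition val :: "'a list \<Rightarrow> 'a" where
  "val a = foldr (\<lambda>s x. s \<otimes> x) a \<one>"

lemma val_Nil [simp]: "val [] = \<one>"
  and val_Cons [simp]: "val (s # a) = s \<otimes> val a"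
  by (simp_all add: val_def)

lemma S_carrier: "s \<in> S \<Longrightarrow> s \<in> carrier W"
  using cox by (auto simp: coxeter_system_def)

lemma S_square: assumes "s \<in> S" shows "s \<otimes> s = \<one>"
proof -
  have "ord s = 2" using cox assms by (auto simp: coxeter_system_def)
  then have "s [^] (2::nat) = \<one>" using pow_ord_eq_1[OF S_carrier[OF assms]] by simp
  then show ?thesis by (simp add: numeral_2_eq_2 S_carrier[OF assms])
qed

lemma S_cancel_left: "s \<in> S \<Longrightarrow> x \<in> carrier W \<Longrightarrow> s \<otimes> (s \<otimes> x) = x"
  by (metis S_carrier S_square l_one m_assoc)

lemma S_cancel_right: "s \<in> S \<Longrightarrow> x \<in> carrier W \<Longrightarrow> x \<otimes> s \<otimes> s = x"
  by (simp add: S_carrier S_square m_assoc)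

lemma S_inv: "s \<in> S \<Longrightarrow> inv s = s"
  by (simp add: S_carrier S_square inv_equality)

lemma S_conj_eq_iff:
  assumes "s \<in> S" "x \<in> carrier W" "y \<in> carrier W"
  shows "s \<otimes> x \<otimes> s = y \<longleftrightarrow> x = s \<otimes> y \<otimes> s"
  using assms by (metis S_cancel_left S_cancel_right S_carrier m_closed m_assoc)

lemma val_closed [simp]: "set a \<subseteq> S \<Longrightarrow> val a \<in> carrier W"
  by (induction a) (auto simp: S_carrier)

lemma val_append: "set a \<subseteq> S \<Longrightarrow> set b \<subseteq> S \<Longrightarrow> val (a @ b) = val a \<otimes> val b"
  by (induction a) (auto simp: S_carrier m_assoc)

lemma val_rev: "set a \<subseteq> S \<Longrightarrow> val (rev a) = inv (val a)"
  by (induction a) (auto simp: val_append S_carrier inv_mult_group S_inv)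

text \<open>The inversions of a word \<open>s\<^sub>1 \<dots> s\<^sub>k\<close> are \<open>s\<^sub>1 \<dots> s\<^sub>i \<dots> s\<^sub>1\<close> for
  \<open>i = 1, \<dots>, k\<close>; the parity of the multiplicity of \<open>t\<close> among them depends only on the value of the
  word.\<close>

fun inversion_parity :: "'a list \<Rightarrow> 'a \<Rightarrow> bool" where
  "inversion_parity [] t = False"
| "inversion_parity (s # a) t = ((t = s) \<noteq> inversion_parity a (s \<otimes> t \<otimes> s))"

text \<open>The inversions of \<open>a @ b\<close> are those of \<open>a\<close>, followed by those
  of \<open>b\<close> conjugated by \<open>val a\<close>; the conjugation is undone on
  \<open>t\<close>.\<close>

lemma inversion_parity_append:
  assumes "set a \<subseteq> S" "set b \<subseteq> S" "t \<in> carrier W"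
  shows "inversion_parity (a @ b) t =
    (inversion_parity a t \<noteq> inversion_parity b (inv (val a) \<otimes> t \<otimes> val a))"
  using assms
proof (induction a arbitrary: t)
  case (Cons s a)
  then have [simp]: "s \<in> S" "s \<in> carrier W" "val a \<in> carrier W" "t \<in> carrier W" by (auto simp: S_carrier)
  have "inv (val (s # a)) \<otimes> t \<otimes> val (s # a) = inv (val a) \<otimes> (s \<otimes> t \<otimes> s) \<otimes> val a"
    by (simp add: inv_mult_group S_inv m_assoc)
  then show ?case using Cons by auto
qed auto

text \<open>If \<open>t\<close> is the inversion contributed by the letter \<open>y\<close>, left
  multiplication by \<open>t\<close> cancels exactly that letter. Odd parity ensures that
  \<open>t\<close> occurs at all.\<close>

lemma inversion_parity_delete:
  assumes "inversion_parity a t" "set a \<subseteq> S" "t \<in> carrier W"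
  shows "\<exists>xs y ys. a = xs @ y # ys \<and> t \<otimes> val a = val (xs @ ys)"
  using assms
proof (induction a arbitrary: t)
  case (Cons s a)
  then have [simp]: "s \<in> S" "s \<in> carrier W" "val a \<in> carrier W" "t \<in> carrier W" by (auto simp: S_carrier)
  show ?case
  proof (cases "t = s")
    case True
    then have "s # a = [] @ s # a \<and> t \<otimes> val (s # a) = val ([] @ a)"
      by (simp add: S_cancel_left)
    then show ?thesis by blast
  next
    case False
    with Cons.prems have "inversion_parity a (s \<otimes> t \<otimes> s)" by simp
    from Cons.IH[OF this] Cons.prems obtain xs y ys where
      *: "a = xs @ y # ys" "s \<otimes> t \<otimes> s \<otimes> val a = val (xs @ ys)" by auto
    have "t \<otimes> val (s # a) = s \<otimes> (s \<otimes> t \<otimes> s \<otimes> val a)"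
      by (simp add: m_assoc S_cancel_left)
    then have "s # a = (s # xs) @ y # ys \<and> t \<otimes> val (s # a) = val ((s # xs) @ ys)"
      using * by simp
    then show ?thesis by blast
  qed
qed auto

text \<open>The inversions of the word \<open>s t s t ...\<close> are, in order, the elements
  \<open>(s \<otimes> t) [^] i \<otimes> s\<close>; the sum counts how often \<open>x\<close> is
  among them.\<close>

lemma inversion_parity_alternating:
  assumes [simp]: "s \<in> S" "t \<in> S" and "x \<in> carrier W"
  shows "inversion_parity (concat (replicate k [s, t])) x =
    odd (\<Sum>i<2*k. of_bool (x = (s \<otimes> t) [^] i \<otimes> s) :: nat)"
  using assms(3)
proof (induction k arbitrary: x)
  case (Suc k)
  note [simp] = S_carrier[OF assms(1)] S_carrier[OF assms(2)] Suc.prems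
  have 1: "s \<otimes> x \<otimes> s = t \<longleftrightarrow> x = (s \<otimes> t) [^] (1::nat) \<otimes> s"
    by (subst S_conj_eq_iff) auto
  \<comment> \<open>Stripping the two leading letters conjugates \<open>x\<close> by
    \<open>s\<close> and then by \<open>t\<close>, which shifts the exponent by two.\<close>
  have 2: "t \<otimes> (s \<otimes> x \<otimes> s) \<otimes> t = (s \<otimes> t) [^] i \<otimes> s \<longleftrightarrow> x = (s \<otimes> t) [^] Suc (Suc i) \<otimes> s" for i :: nat
  proof -
    have "t \<otimes> (s \<otimes> x \<otimes> s) \<otimes> t = (s \<otimes> t) [^] i \<otimes> s \<longleftrightarrow>
          x = s \<otimes> (t \<otimes> ((s \<otimes> t) [^] i \<otimes> s) \<otimes> t) \<otimes> s"
      by (subst S_conj_eq_iff, simp_all, subst S_conj_eq_iff, simp_all)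
    also have "s \<otimes> (t \<otimes> ((s \<otimes> t) [^] i \<otimes> s) \<otimes> t) \<otimes> s = ((s \<otimes> t) \<otimes> (s \<otimes> t) [^] i) \<otimes> (s \<otimes> t) \<otimes> s"
      by (simp add: m_assoc)
    also have "(s \<otimes> t) \<otimes> (s \<otimes> t) [^] i = (s \<otimes> t) [^] Suc i"
      by (rule nat_pow_Suc2[symmetric]) simp
    finally show ?thesis by simp
  qed
  have "(\<Sum>i<2 * Suc k. of_bool (x = (s \<otimes> t) [^] i \<otimes> s) :: nat) =
    of_bool (x = s) + (of_bool (x = (s \<otimes> t) [^] (1::nat) \<otimes> s) +
      (\<Sum>i<2*k. of_bool (x = (s \<otimes> t) [^] Suc (Suc i) \<otimes> s)))"
    by (simp add: sum.lessThan_Suc_shift del: sum.lessThan_Suc)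
  also have "odd \<dots> = ((x = s) \<noteq> ((s \<otimes> x \<otimes> s = t) \<noteq> 
     odd (\<Sum>i<2*k. of_bool (t \<otimes> (s \<otimes> x \<otimes> s) \<otimes> t = (s \<otimes> t) [^] i \<otimes> s) :: nat)))"
    unfolding 1 2 by simp
  also have "\<dots> = inversion_parity (concat (replicate (Suc k) [s, t])) x"
    by (simp add: Suc.IH)
  finally show ?case by simp
qed simp

text \<open>The inversions of the relator run twice through a period of the powers of
  \<open>s \<otimes> t\<close>, so each is counted an even number of times.\<close>

lemma inversion_parity_relator:
  assumes "s \<in> S" "t \<in> S" "x \<in> carrier W"
  shows "\<not> inversion_parity (concat (replicate (ord (s \<otimes> t)) [s, t])) x"
proof -
  define f where "f i = (of_bool (x = (s \<otimes> t) [^] i \<otimes> s) :: nat)" for i :: nat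
  let ?m = "ord (s \<otimes> t)"
  note [simp] = S_carrier[OF assms(1)] S_carrier[OF assms(2)]
  have per: "f (i + ?m) = f i" for i
    by (simp add: f_def nat_pow_mult[symmetric] pow_ord_eq_1)
  have "(\<Sum>i<2 * ?m. f i) = (\<Sum>i<?m. f i) + (\<Sum>i<?m. f (i + ?m))"
    using sum.atLeastLessThan_concat[of 0 ?m "?m + ?m" f] sum.shift_bounds_nat_ivl[of f 0 ?m ?m]
    by (simp only: mult_2 lessThan_atLeast0 add_0)
  then have "even (\<Sum>i<2 * ?m. f i)" by (simp add: per)
  then show ?thesis unfolding inversion_parity_alternating[OF assms] f_def by simp
qed

section \<open>Invariance of the inversion parity under the relations\<close>

lemma word_value_eq: "a \<in> signed_words S \<Longrightarrow> word_value W a = val (map fst a)"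
  by (induction a) (auto simp: signed_words_def word_value_def S_inv)

lemma signed_words_fst: "a \<in> signed_words S \<Longrightarrow> set (map fst a) \<subseteq> S"
  by (auto simp: signed_words_def)

lemma presentation: "group_presentation W S (coxeter_relators W S)"
  using cox by (simp add: coxeter_system_def)

text \<open>A cancelling pair contributes the same inversion twice, and a relator contributes every
  element an even number of times. Both have value \<open>\<one>\<close>, so the inversions coming
  from later letters stay the same.\<close>

lemma presented_eq_inversion_parity:
  assumes "presented_eq S (coxeter_relators W S) a b"
  shows "\<forall>x\<in>carrier W. inversion_parity (map fst a) x = inversion_parity (map fst b) x"
  using assms
proof (induction rule: presented_eq.induct)
  case (cancel a b s e)
  note sw = cancel(1,2)[THEN signed_words_fst]
  have "inversion_parity (map fst (a @ [(s, e), (s, \<not> e)] @ b)) x = inversion_parity (map fst (a @ b)) x"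
    if x: "x \<in> carrier W" for x
  proof -
    define y where "y = inv (val (map fst a)) \<otimes> x \<otimes> val (map fst a)"
    have y: "y \<in> carrier W" using sw x by (simp add: y_def)
    have "s \<otimes> y \<otimes> s = s \<longleftrightarrow> y = s"
      using cancel(3) y S_carrier[OF cancel(3)]
      by (subst S_conj_eq_iff) (simp_all add: S_cancel_right)
    moreover have "s \<otimes> (s \<otimes> y \<otimes> s) \<otimes> s = y"
      using cancel(3) y S_carrier[OF cancel(3)] by (simp add: m_assoc S_cancel_left S_square)
    ultimately have "inversion_parity ([s, s] @ map fst b) y = inversion_parity (map fst b) y" by auto
    then show ?thesis
      using sw x cancel(3) by (simp add: inversion_parity_append y_def del: inversion_parity.simps)
  qed
  then show ?case by blast
next
  case (relator a b r)
  note sw = relator(1,2)[THEN signed_words_fst]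
  obtain s t where st: "s \<in> S" "t \<in> S" "r = concat (replicate (ord (s \<otimes> t)) [(s, True), (t, True)])"
    using relator(3) by (auto simp: coxeter_relators_def)
  have mr: "map fst r = concat (replicate (ord (s \<otimes> t)) [s, t])"
    by (simp add: st(3) map_concat)
  have rS: "set (map fst r) \<subseteq> S" using st by (auto simp: mr)
  have "val (map fst r) = (s \<otimes> t) [^] (ord (s \<otimes> t))"
  proof -
    have "val (concat (replicate k [s, t])) = (s \<otimes> t) [^] k" for k :: nat
    proof (induction k)
      case (Suc k)
      have "(s \<otimes> t) [^] Suc k = (s \<otimes> t) \<otimes> (s \<otimes> t) [^] k"
        by (rule nat_pow_Suc2) (use st S_carrier in simp)
      then show ?case using Suc st by (simp add: S_carrier m_assoc)
    qed simp
    then show ?thesis by (simp add: mr)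
  qed
  then have v1: "val (map fst r) = \<one>" using st by (simp add: S_carrier pow_ord_eq_1)
  have "inversion_parity (map fst (a @ r @ b)) x = inversion_parity (map fst (a @ b)) x"
    if x: "x \<in> carrier W" for x
  proof -
    define y where "y = inv (val (map fst a)) \<otimes> x \<otimes> val (map fst a)"
    have y: "y \<in> carrier W" using sw x by (simp add: y_def)
    have "inversion_parity (map fst r @ map fst b) y = inversion_parity (map fst b) y"
      using y rS sw inversion_parity_relator[OF st(1,2) y] 
      by (simp only: inversion_parity_append v1 mr[symmetric]) simp
    then show ?thesis
      using sw x rS by (simp add: inversion_parity_append y_def)
  qed
  then show ?case by blast
qed auto

text \<open>Here the Coxeter relations enter: by the presentation, words with equal values are
  linked by moves that preserve the parity.\<close>

lemma inversion_parity_cong: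
  assumes "set a \<subseteq> S" "set b \<subseteq> S" "val a = val b" "x \<in> carrier W"
  shows "inversion_parity a x = inversion_parity b x"
proof -
  let ?s = "map (\<lambda>s. (s, True))"
  have m: "map fst (?s c) = c" for c by (simp add: comp_def)
  have sw: "?s a \<in> signed_words S" "?s b \<in> signed_words S"
    using assms by (auto simp: signed_words_def)
  have "word_value W (?s a) = word_value W (?s b)"
    using assms(3) by (simp only: word_value_eq[OF sw(1)] word_value_eq[OF sw(2)] m)
  then have "presented_eq S (coxeter_relators W S) (?s a) (?s b)"
    using presentation sw by (auto simp: group_presentation_def)
  from presented_eq_inversion_parity[OF this] show ?thesis
    using assms(4) by (simp only: m)
qed

lemma ex_word: assumes "w \<in> carrier W" shows "\<exists>a. set a \<subseteq> S \<and> val a = w"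
proof -
  have "w \<in> generate W S" using presentation assms by (simp add: group_presentation_def)
  then show ?thesis
  proof (induction rule: generate.induct)
    case one then show ?case by (intro exI[of _ "[]"]) simp
  next
    case (incl h) then show ?case by (intro exI[of _ "[h]"]) (simp add: S_carrier)
  next
    case (inv h) then show ?case by (intro exI[of _ "[h]"]) (simp add: S_carrier S_inv)
  next
    case (eng h g) then show ?case by (metis val_append set_append Un_least)
  qed
qed

section \<open>Length and reduced words\<close>

definition reduced :: "'a list \<Rightarrow> bool" where
  "reduced a \<longleftrightarrow> set a \<subseteq> S \<and> length a = len (val a)"

lemma len_le: assumes "set a \<subseteq> S" shows "len (val a) \<le> length a"
  unfolding cox_length_def by (rule Least_le) (use assms in \<open>auto simp: val_def\<close>)

lemma ex_reduced: assumes "w \<in> carrier W" obtains a where "reduced a" "val a = w"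
proof -
  have "\<exists>a. set a \<subseteq> S \<and> length a = len w \<and> foldr (\<lambda>s x. s \<otimes> x) a \<one> = w"
    unfolding cox_length_def by (rule LeastI_ex) (use ex_word[OF assms] in \<open>auto simp: val_def\<close>)
  then show ?thesis using that by (auto simp: val_def reduced_def)
qed

lemma len_one [simp]: "len \<one> = 0"
  using len_le[of "[]"] by simp

lemma len_eq_0: "w \<in> carrier W \<Longrightarrow> len w = 0 \<Longrightarrow> w = \<one>"
  by (metis ex_reduced length_0_conv reduced_def val_Nil)

lemma len_inv: assumes "w \<in> carrier W" shows "len (inv w) = len w"
proof -
  have "len (inv x) \<le> len x" if x: "x \<in> carrier W" for x
  proof -
    obtain a where "reduced a" "val a = x" using ex_reduced[OF x] .
    then show ?thesis using len_le[of "rev a"] by (simp add: val_rev reduced_def)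
  qed
  from this[of w] this[of "inv w"] assms show ?thesis by simp
qed

lemma len_mult_le:
  assumes "x \<in> carrier W" "y \<in> carrier W"
  shows "len (x \<otimes> y) \<le> len x + len y"
proof -
  obtain a b where "reduced a" "val a = x" "reduced b" "val b = y"
    using ex_reduced assms by metis
  then show ?thesis using len_le[of "a @ b"] by (simp add: val_append reduced_def)
qed

lemma len_S: "s \<in> S \<Longrightarrow> len s \<le> 1"
  using len_le[of "[s]"] by (simp add: S_carrier)

section \<open>Reflections and the exchange condition\<close>

abbreviation refl :: "'a set" where "refl \<equiv> cox_reflections W S"

lemma refl_carrier: "t \<in> refl \<Longrightarrow> t \<in> carrier W"
  by (auto simp: cox_reflections_def S_carrier)

lemma S_refl: "s \<in> S \<Longrightarrow> s \<in> refl"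
  unfolding cox_reflections_def by (intro CollectI exI[of _ \<one>] exI[of _ s]) (simp add: S_carrier)

lemma refl_conj:
  assumes "t \<in> refl" "x \<in> carrier W" shows "x \<otimes> t \<otimes> inv x \<in> refl"
proof -
  obtain w s where *: "w \<in> carrier W" "s \<in> S" "t = w \<otimes> s \<otimes> inv w"
    using assms by (auto simp: cox_reflections_def)
  then have "x \<otimes> t \<otimes> inv x = (x \<otimes> w) \<otimes> s \<otimes> inv (x \<otimes> w)"
    using assms by (simp add: S_carrier inv_mult_group m_assoc)
  then show ?thesis using * assms by (auto simp: cox_reflections_def)
qed

lemma refl_square: assumes "t \<in> refl" shows "t \<otimes> t = \<one>"
proof -
  obtain w s where *: "w \<in> carrier W" "s \<in> S" "t = w \<otimes> s \<otimes> inv w"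
    using assms by (auto simp: cox_reflections_def)
  then have "inv w \<otimes> (w \<otimes> (s \<otimes> inv w)) = s \<otimes> inv w"
    by (simp add: S_carrier m_assoc[symmetric])
  then show ?thesis using * by (simp add: S_carrier S_cancel_left m_assoc)
qed

text \<open>Spell \<open>t\<close> as the palindrome \<open>b @ [s] @ rev b\<close>. As
  \<open>b @ rev b\<close> has value \<open>\<one>\<close>, the contributions of \<open>b\<close>
  and \<open>rev b\<close> cancel modulo 2, and only the middle letter is left.\<close>

lemma inversion_parity_self:
  assumes "t \<in> refl" "set a \<subseteq> S" "val a = t" shows "inversion_parity a t"
proof -
  obtain w s where *: "w \<in> carrier W" "s \<in> S" "t = w \<otimes> s \<otimes> inv w"
    using assms by (auto simp: cox_reflections_def)
  obtain b where b: "set b \<subseteq> S" "val b = w" using ex_word[OF *(1)] by blast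
  have tc: "t \<in> carrier W" using assms refl_carrier by simp
  note [simp] = *(1,2) S_carrier[OF *(2)] b
  have conj: "inv w \<otimes> t \<otimes> w = s"
  proof -
    have "inv w \<otimes> (w \<otimes> s) = s" by (simp add: m_assoc[symmetric])
    then show ?thesis using *(3) by (simp add: m_assoc)
  qed
  have "inversion_parity (b @ [s] @ rev b) t =
    (inversion_parity b t \<noteq> (True \<noteq> inversion_parity (rev b) s))"
    using tc by (simp add: inversion_parity_append conj S_square S_cancel_right)
  also have "inversion_parity (rev b) s = inversion_parity b t"
  proof -
    have "inversion_parity (b @ rev b) t = inversion_parity [] t"
      by (rule inversion_parity_cong) (auto simp: val_append val_rev tc)
    then show ?thesis using tc by (simp add: inversion_parity_append conj)
  qed
  finally have "inversion_parity (b @ [s] @ rev b) t" by simp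
  moreover have "inversion_parity (b @ [s] @ rev b) t = inversion_parity a t"
    using assms by (intro inversion_parity_cong) (auto simp: val_append val_rev tc * m_assoc)
  ultimately show ?thesis by simp
qed

lemma len_refl_cases:
  assumes "t \<in> refl" "set a \<subseteq> S" "w = val a"
  shows "inversion_parity a t \<and> len (t \<otimes> w) < len w \<or> \<not> inversion_parity a t \<and> len w < len (t \<otimes> w)"
proof -
  have tc: "t \<in> carrier W" using assms refl_carrier by simp
  \<comment> \<open>A reduced word for the same element has the same parity, and deleting a letter
    from it gives a strictly smaller length.\<close>
  have dec: "len (t \<otimes> val c) < len (val c)" if c: "inversion_parity c t" "set c \<subseteq> S" for c
  proof -
    obtain d where d: "reduced d" "val d = val c" using ex_reduced[OF val_closed[OF c(2)]] .
    then have dS: "set d \<subseteq> S" by (simp add: reduced_def)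
    have "inversion_parity d t"
      using c(1) inversion_parity_cong[OF dS c(2) d(2) tc] by simp
    from inversion_parity_delete[OF this dS tc] obtain xs y ys where *: "d = xs @ y # ys" "t \<otimes> val d = val (xs @ ys)"
      by blast
    then show ?thesis using len_le[of "xs @ ys"] d by (auto simp: reduced_def)
  qed
  show ?thesis
  proof (cases "inversion_parity a t")
    case True
    then show ?thesis using dec assms by simp
  next
    case False
    \<comment> \<open>Prepending a word for \<open>t\<close> flips the parity: \<open>t\<close> is
      an inversion of that word, and conjugation by \<open>t\<close> fixes \<open>t\<close>. So
      \<open>t\<close> shortens \<open>t \<otimes> w\<close>.\<close>
    obtain b where b: "set b \<subseteq> S" "val b = t" using ex_word[OF tc] by blast
    have "inversion_parity (b @ a) t"
      using False inversion_parity_self[OF assms(1) b] b assms tc refl_square[OF assms(1)]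
      by (simp add: inversion_parity_append)
    from dec[OF this] have "len (t \<otimes> (t \<otimes> w)) < len (t \<otimes> w)"
      using b assms by (simp add: val_append)
    moreover have "t \<otimes> (t \<otimes> w) = w"
      using assms tc by (simp add: m_assoc[symmetric] refl_square)
    ultimately show ?thesis using False by simp
  qed
qed

text \<open>Right multiplication by \<open>t\<close> is left multiplication by its conjugate under
  \<open>val a\<close>, so the drop in length forces odd parity, and odd parity deletes a
  letter.\<close>

lemma strong_exchange:
  assumes "t \<in> refl" "set a \<subseteq> S" "len (val a \<otimes> t) < len (val a)"
  shows "\<exists>xs y ys. a = xs @ y # ys \<and> val a \<otimes> t = val (xs @ ys)"
proof -
  let ?t = "val a \<otimes> t \<otimes> inv (val a)"
  have t: "?t \<in> refl" using assms refl_conj by simp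
  have eq: "?t \<otimes> val a = val a \<otimes> t" using assms refl_carrier by (simp add: m_assoc)
  have "inversion_parity a ?t"
    using len_refl_cases[OF t assms(2) HOL.refl] assms(3) unfolding eq by auto
  from inversion_parity_delete[OF this assms(2) refl_carrier[OF t]] show ?thesis unfolding eq .
qed

lemma len_mult_refl_neq:
  assumes "t \<in> refl" "w \<in> carrier W" shows "len (w \<otimes> t) \<noteq> len w"
proof -
  obtain a where a: "set a \<subseteq> S" "val a = w" using ex_word assms by blast
  have "w \<otimes> t \<otimes> inv w \<otimes> w = w \<otimes> t" using assms refl_carrier by (simp add: m_assoc)
  then show ?thesis
    using len_refl_cases[OF refl_conj[OF assms] a(1) a(2)[symmetric]] by auto
qed

section \<open>Descents, and the interplay of left and right multiplication\<close>

lemma len_right: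
  assumes "s \<in> S" "w \<in> carrier W"
  shows "len (w \<otimes> s) = Suc (len w) \<or> len w = Suc (len (w \<otimes> s))"
proof -
  have "len (w \<otimes> s) \<le> len w + len s" "len (w \<otimes> s \<otimes> s) \<le> len (w \<otimes> s) + len s"
    using assms by (auto intro!: len_mult_le simp: S_carrier)
  then show ?thesis
    using len_mult_refl_neq[OF S_refl assms(2), OF assms(1)] len_S[OF assms(1)] assms S_cancel_right
    by fastforce
qed

lemma len_left_inv:
  assumes "s \<in> S" "w \<in> carrier W" shows "len (s \<otimes> w) = len (inv w \<otimes> s)"
  using len_inv[of "s \<otimes> w"] assms by (simp add: inv_mult_group S_inv S_carrier)

lemma len_left:
  assumes "s \<in> S" "w \<in> carrier W"
  shows "len (s \<otimes> w) = Suc (len w) \<or> len w = Suc (len (s \<otimes> w))"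
  using len_right[OF assms(1), of "inv w"] assms by (simp add: len_left_inv len_inv)

lemma ex_right_descent:
  assumes "w \<in> carrier W" "w \<noteq> \<one>" shows "\<exists>s\<in>S. len (w \<otimes> s) < len w"
proof -
  obtain a where a: "reduced a" "val a = w" using ex_reduced[OF assms(1)] .
  with assms obtain b s where b: "a = b @ [s]" by (cases a rule: rev_cases) auto
  with a have *: "set b \<subseteq> S" "s \<in> S" "w = val b \<otimes> s"
    by (auto simp: reduced_def val_append S_carrier)
  then have "w \<otimes> s = val b" by (simp add: S_cancel_right)
  then show ?thesis using * a b len_le[of b] by (intro bexI[of _ s]) (auto simp: reduced_def)
qed

lemma ex_left_descent:
  assumes "w \<in> carrier W" "w \<noteq> \<one>" shows "\<exists>s\<in>S. len (s \<otimes> w) < len w"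
  using ex_right_descent[of "inv w"] assms by (auto simp: len_left_inv len_inv)

text \<open>Lengths force \<open>s \<otimes> x \<otimes> t\<close> to be shorter than
  \<open>s \<otimes> x\<close>. Strong exchange deletes a letter from \<open>s\<close> followed by a
  reduced word for \<open>x\<close>, and this letter has to be the leading \<open>s\<close>.\<close>

lemma left_right_ascent:
  assumes "s \<in> S" "t \<in> S" "x \<in> carrier W"
    and "len (s \<otimes> x) > len x" "len (s \<otimes> (x \<otimes> t)) < len (x \<otimes> t)"
  shows "s \<otimes> x = x \<otimes> t"
proof -
  note [simp] = assms(1-3) S_carrier[OF assms(1)] S_carrier[OF assms(2)]
  have "len (s \<otimes> x \<otimes> t) < len (s \<otimes> x)"
    using assms(4,5) len_left[of s x] len_right[of t x] len_left[of s "x \<otimes> t"]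
    by (auto simp: m_assoc)
  moreover obtain a where a: "reduced a" "val a = x" using ex_reduced[OF assms(3)] .
  ultimately obtain xs y ys where *: "s # a = xs @ y # ys" "s \<otimes> x \<otimes> t = val (xs @ ys)"
    using strong_exchange[OF S_refl[OF assms(2)], of "s # a"] by (auto simp: reduced_def)
  show ?thesis
  proof (cases xs)
    case Nil
    then have "s \<otimes> x \<otimes> t = x" using * a by simp
    then have "s \<otimes> x \<otimes> t \<otimes> t = x \<otimes> t" by simp
    then show ?thesis by (simp add: S_cancel_right)
  next
    \<comment> \<open>Now \<open>x \<otimes> t\<close> is shorter than \<open>x\<close>, so
      \<open>s \<otimes> x \<otimes> t\<close> has length \<open>len x - 2\<close>, although it is
      one generator away from \<open>s \<otimes> x\<close>, of length
      \<open>len x + 1\<close>.\<close>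
    case (Cons z zs)
    then have zs: "a = zs @ y # ys" "s \<otimes> (x \<otimes> t) = s \<otimes> val (zs @ ys)" 
      using * m_assoc[OF S_carrier[OF assms(1)] assms(3) S_carrier[OF assms(2)]] by auto
    then have "set (zs @ ys) \<subseteq> S" using a by (auto simp: reduced_def)
    then have "x \<otimes> t = val (zs @ ys)" using zs by (metis S_cancel_left assms(1,3) S_carrier assms(2) m_closed val_closed)
    then have "len (x \<otimes> t) < len x" using len_le[OF \<open>set (zs @ ys) \<subseteq> S\<close>] zs(1) a by (auto simp: reduced_def)
    then show ?thesis using assms(4,5) len_left[of s x] len_right[of t x] len_left[of s "x \<otimes> t"]
      len_right[of t "s \<otimes> x"] by (auto simp: m_assoc)
  qed
qed

text \<open>A change of descent status contradicts \<open>left_right_ascent\<close>, applied to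
  \<open>x\<close> if \<open>s\<close> is an ascent of \<open>x\<close> and to
  \<open>s \<otimes> x\<close> otherwise.\<close>

lemma left_descent_mult_right:
  assumes "s \<in> S" "t \<in> S" "x \<in> carrier W" "s \<otimes> x \<noteq> x \<otimes> t"
  shows "len (s \<otimes> (x \<otimes> t)) < len (x \<otimes> t) \<longleftrightarrow> len (s \<otimes> x) < len x"
proof (rule ccontr)
  note [simp] = assms(1-3) S_carrier[OF assms(1)] S_carrier[OF assms(2)]
  assume neq: "\<not> ?thesis"
  show False
  proof (cases "len (s \<otimes> x) < len x")
    case False
    then show False using neq left_right_ascent[OF assms(1-3)] assms(4) len_left[of s x] by auto
  next
    case True
    then have "s \<otimes> (s \<otimes> x) = (s \<otimes> x) \<otimes> t"
      using neq len_left[of s "x \<otimes> t"]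
      by (intro left_right_ascent) (auto simp: S_cancel_left m_assoc)
    then have "x \<otimes> t = s \<otimes> x \<otimes> t \<otimes> t" by (simp add: S_cancel_left)
    then show False using assms(4) by (simp add: S_cancel_right)
  qed
qed

text \<open>Mirror image of \<open>left_descent_mult_right\<close>, obtained by passing to
  inverses.\<close>

lemma right_descent_mult_left:
  assumes "s \<in> S" "t \<in> S" "x \<in> carrier W" "s \<otimes> x \<noteq> x \<otimes> t"
  shows "len (s \<otimes> x \<otimes> t) < len (s \<otimes> x) \<longleftrightarrow> len (x \<otimes> t) < len x"
proof -
  note [simp] = assms(1-3) S_carrier[OF assms(1)] S_carrier[OF assms(2)]
  have "t \<otimes> inv x \<noteq> inv x \<otimes> s"
  proof
    assume "t \<otimes> inv x = inv x \<otimes> s"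
    then have "inv (t \<otimes> inv x) = inv (inv x \<otimes> s)" by simp
    then show False using assms(4) by (simp add: inv_mult_group S_inv)
  qed
  from left_descent_mult_right[OF assms(2,1) _ this] 
  have *: "len (t \<otimes> (inv x \<otimes> s)) < len (inv x \<otimes> s) \<longleftrightarrow> len (t \<otimes> inv x) < len (inv x)" by simp
  have "inv (s \<otimes> x \<otimes> t) = t \<otimes> (inv x \<otimes> s)" "inv (s \<otimes> x) = inv x \<otimes> s" "inv (x \<otimes> t) = t \<otimes> inv x"
    by (simp_all add: inv_mult_group S_inv)
  then show ?thesis
    using * len_inv[of "s \<otimes> x \<otimes> t"] len_inv[of "s \<otimes> x"] len_inv[of "x \<otimes> t"] len_inv[of x] by simp
qed

section \<open>Bruhat order\<close>

abbreviation ble :: "'a \<Rightarrow> 'a \<Rightarrow> bool" where "ble \<equiv> bruhat_le W S"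

text \<open>The new pair differs by the reflection \<open>s \<otimes> t \<otimes> s\<close>, so only
  the direction could fail. If it did, strong exchange would delete a letter from a reduced word for
  \<open>u\<close> followed by \<open>s\<close>: deleting the final \<open>s\<close> means
  \<open>u \<otimes> s = v\<close>, and deleting an earlier letter makes \<open>v\<close> shorter
  than \<open>u\<close>.\<close>

lemma bruhat_step_right:
  assumes "bruhat_step W S u v" "s \<in> S" "u \<otimes> s \<noteq> v"
  shows "bruhat_step W S (u \<otimes> s) (v \<otimes> s)"
proof -
  obtain t where t: "t \<in> refl" "v = u \<otimes> t" and u: "u \<in> carrier W" and lt: "len u < len v"
    using assms by (auto simp: bruhat_step_def)
  note [simp] = assms(2) S_carrier[OF assms(2)] refl_carrier[OF t(1)] u
  have t': "s \<otimes> t \<otimes> s \<in> refl" using refl_conj[OF t(1), of s] by (simp add: S_inv)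
  have eq: "v \<otimes> s = u \<otimes> s \<otimes> (s \<otimes> t \<otimes> s)"
    using t by (simp add: m_assoc S_cancel_left)
  have "len (u \<otimes> s) < len (v \<otimes> s)"
  proof (rule ccontr)
    assume "\<not> ?thesis"
    then have less: "len (v \<otimes> s) < len (u \<otimes> s)"
      using len_mult_refl_neq[OF t', of "u \<otimes> s"] unfolding eq by simp
    then have up: "len (u \<otimes> s) = Suc (len u)"
      using len_right[of s u] len_right[of s v] lt t by auto
    obtain a where a: "reduced a" "val a = u" using ex_reduced[OF u] .
    have aS: "set (a @ [s]) \<subseteq> S" and va: "val (a @ [s]) = u \<otimes> s"
      using a by (auto simp: reduced_def val_append)
    have "\<exists>xs y ys. a @ [s] = xs @ y # ys \<and> val (a @ [s]) \<otimes> (s \<otimes> t \<otimes> s) = val (xs @ ys)"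
      by (rule strong_exchange[OF t' aS]) (use less in \<open>simp only: va eq\<close>)
    then obtain xs y ys where *: "a @ [s] = xs @ y # ys" "v \<otimes> s = val (xs @ ys)"
      unfolding va eq by blast
    show False
    proof (cases ys rule: rev_cases)
      case Nil
      then have "v \<otimes> s = u" using * a by simp
      then have "v = u \<otimes> s" using S_cancel_right[of s v] t by simp
      then show False using assms(3) by simp
    next
      case (snoc zs z)
      then have zs: "a = xs @ y # zs" "z = s" using * by auto
      then have S': "set (xs @ zs) \<subseteq> S" using a by (auto simp: reduced_def)
      have "v \<otimes> s = val ((xs @ zs) @ [s])" using *(2) snoc zs by simp
      also have "\<dots> = val (xs @ zs) \<otimes> s" using S' by (subst val_append) auto
      finally have "v = val (xs @ zs)" using S' t by simp
      then have "len v < length a" using len_le[OF S'] zs by simp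
      then show False using lt a by (simp add: reduced_def)
    qed
  qed
  then show ?thesis using t' eq by (auto simp: bruhat_step_def)
qed

lemma ble_refl: "u \<in> carrier W \<Longrightarrow> ble u u"
  by (simp add: bruhat_le_def)

lemma ble_trans: "ble u v \<Longrightarrow> ble v w \<Longrightarrow> ble u w"
  by (auto simp: bruhat_le_def)

lemma bruhat_step_carrier: "bruhat_step W S u v \<Longrightarrow> u \<in> carrier W \<and> v \<in> carrier W"
  by (auto simp: bruhat_step_def refl_carrier)

lemma bruhat_step_ble: "bruhat_step W S u v \<Longrightarrow> ble u v"
  using bruhat_step_carrier by (auto simp: bruhat_le_def)

lemma ble_right_ascent:
  assumes "s \<in> S" "u \<in> carrier W" "len u < len (u \<otimes> s)" shows "ble u (u \<otimes> s)"
  by (rule bruhat_step_ble) (use assms S_refl in \<open>auto simp: bruhat_step_def\<close>)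

lemma ble_right_descent:
  assumes "s \<in> S" "u \<in> carrier W" "len (u \<otimes> s) < len u" shows "ble (u \<otimes> s) u"
  using ble_right_ascent[of s "u \<otimes> s"] assms by (simp add: S_cancel_right S_carrier)

lemma ble_len: assumes "ble u v" shows "len u \<le> len v"
proof -
  have "(bruhat_step W S)\<^sup>*\<^sup>* u v" using assms by (simp add: bruhat_le_def)
  then show ?thesis by induction (auto simp: bruhat_step_def)
qed

lemma ble_one: "ble u \<one> \<Longrightarrow> u = \<one>"
  using ble_len[of u \<one>] len_eq_0[of u] by (auto simp: bruhat_le_def)

text \<open>Multiplying a Bruhat chain by \<open>s\<close> preserves its steps until one goes from
  some element to its product with \<open>s\<close>; there the multiplied chain meets the original
  one and can follow it up to \<open>v\<close>.\<close>

lemma ble_mult_right_upper: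
  assumes "ble u v" "s \<in> S" shows "ble (u \<otimes> s) v \<or> ble (u \<otimes> s) (v \<otimes> s)"
proof -
  have "(bruhat_step W S)\<^sup>*\<^sup>* u v" and v: "v \<in> carrier W" using assms by (auto simp: bruhat_le_def)
  then show ?thesis
  proof (induction rule: converse_rtranclp_induct)
    case base
    then show ?case using ble_refl[of "v \<otimes> s"] assms by (simp add: S_carrier)
  next
    case (step u u')
    then have "ble u' v" using v bruhat_step_carrier by (auto simp: bruhat_le_def)
    then show ?case
      using bruhat_step_right[OF step(1) assms(2)] bruhat_step_ble ble_trans step(3)[OF v] by metis
  qed
qed

lemma ble_mult_right_lower:
  assumes "ble u v" "s \<in> S" shows "ble u (v \<otimes> s) \<or> ble (u \<otimes> s) (v \<otimes> s)"
proof -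
  have "(bruhat_step W S)\<^sup>*\<^sup>* u v" and u: "u \<in> carrier W" using assms by (auto simp: bruhat_le_def)
  then show ?thesis
  proof (induction rule: rtranclp_induct)
    case base
    then show ?case using ble_refl[of "u \<otimes> s"] assms by (simp add: S_carrier)
  next
    case (step v' v)
    then have "ble u v'" using u bruhat_step_carrier by (auto simp: bruhat_le_def)
    show ?case
    proof (cases "v' \<otimes> s = v")
      case True
      then have "v \<otimes> s = v'" using S_cancel_right[of s v'] assms bruhat_step_carrier[OF step(2)] by auto
      then show ?thesis using \<open>ble u v'\<close> by simp
    next
      case False
      then show ?thesis
        using bruhat_step_right[OF step(2) assms(2)] bruhat_step_ble ble_trans step(3)[OF u] by metis
    qed
  qed
qed

lemma lifting_descent:
  assumes "ble u v" "s \<in> S" "len (u \<otimes> s) < len u" shows "ble (u \<otimes> s) (v \<otimes> s)"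
  using ble_mult_right_lower[OF assms(1,2)] ble_right_descent[OF assms(2) _ assms(3)] assms(1) ble_trans
  by (auto simp: bruhat_le_def)

lemma lifting_ascent:
  assumes "ble u v" "s \<in> S" "len u < len (u \<otimes> s)" shows "ble u (v \<otimes> s)"
  using ble_mult_right_lower[OF assms(1,2)] ble_right_ascent[OF assms(2) _ assms(3)] assms(1) ble_trans
  by (auto simp: bruhat_le_def)

section \<open>Hecke operators and existence of the \<open>R\<close>-polynomials\<close>

text \<open>The normalisation is such that the recursion for the
  \<open>R\<close>-polynomials reads \<open>R(\<cdot>, w) = hecke_right q s R(\<cdot>, ws)\<close>. The values outside the carrier
  are chosen such that the quadratic relation holds there as well.\<close>

definition hecke_right :: "'c::idom \<Rightarrow> 'a \<Rightarrow> ('a \<Rightarrow> 'c) \<Rightarrow> 'a \<Rightarrow> 'c" where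
  "hecke_right q s m x =
     (if x \<in> carrier W
      then if len (x \<otimes> s) < len x then m (x \<otimes> s) else (q - 1) * m x + q * m (x \<otimes> s)
      else q * m x)"

definition hecke_left :: "'c::idom \<Rightarrow> 'a \<Rightarrow> ('a \<Rightarrow> 'c) \<Rightarrow> 'a \<Rightarrow> 'c" where
  "hecke_left q s m x =
     (if x \<in> carrier W
      then if len (s \<otimes> x) < len x then m (s \<otimes> x) else (q - 1) * m x + q * m (s \<otimes> x)
      else q * m x)"

text \<open>By the quadratic relation this is \<open>q\<close> times the inverse of
  \<open>hecke_right q s\<close>; the factor \<open>q\<close> avoids division in the coefficient
  ring.\<close>

definition hecke_right_inv :: "'c::idom \<Rightarrow> 'a \<Rightarrow> ('a \<Rightarrow> 'c) \<Rightarrow> 'a \<Rightarrow> 'c" where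
  "hecke_right_inv q s m x = hecke_right q s m x - (q - 1) * m x"

definition delta :: "'a \<Rightarrow> 'a \<Rightarrow> 'c::idom" where
  "delta y x = of_bool (x = y)"

lemma hecke_right_scale: "hecke_right q s (\<lambda>x. c * m x) = (\<lambda>x. c * hecke_right q s m x)"
  by (auto simp: hecke_right_def fun_eq_iff algebra_simps)

text \<open>This is the Hecke relation \<open>(T - q)(T + 1) = 0\<close>, checked on the pair
  \<open>x\<close>, \<open>x \<otimes> s\<close>, exactly one of which has \<open>s\<close> as a
  right descent.\<close>

lemma hecke_right_quadratic:
  assumes "s \<in> S"
  shows "hecke_right q s (hecke_right q s m) x = (q - 1) * hecke_right q s m x + q * m x"
proof (cases "x \<in> carrier W")
  case True
  have "x \<otimes> s \<in> carrier W" "x \<otimes> s \<otimes> s = x"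
    "len (x \<otimes> s) < len x \<longleftrightarrow> \<not> len x < len (x \<otimes> s)"
    using assms len_right[OF assms True] True S_carrier S_cancel_right by auto
  with True show ?thesis
    by (simp add: hecke_right_def algebra_simps)
qed (simp add: hecke_right_def algebra_simps)

lemma hecke_right_diff:
  "hecke_right q s (\<lambda>x. m x - n x) x = hecke_right q s m x - hecke_right q s n x"
  by (auto simp: hecke_right_def algebra_simps)

lemma hecke_left_diff:
  "hecke_left q s (\<lambda>x. m x - n x) x = hecke_left q s m x - hecke_left q s n x"
  by (auto simp: hecke_left_def algebra_simps)

lemma hecke_left_scale: "hecke_left q s (\<lambda>x. c * m x) x = c * hecke_left q s m x"
  by (auto simp: hecke_left_def algebra_simps)

lemma hecke_right_right_inv:
  assumes "s \<in> S" shows "hecke_right q s (hecke_right_inv q s m) = (\<lambda>x. q * m x)"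
proof
  fix x
  have "hecke_right q s (hecke_right_inv q s m) x =
    hecke_right q s (\<lambda>x. hecke_right q s m x - (q - 1) * m x) x"
    by (rule arg_cong[of _ _ "\<lambda>f. hecke_right q s f x"]) (simp add: hecke_right_inv_def fun_eq_iff)
  then show "hecke_right q s (hecke_right_inv q s m) x = q * m x"
    by (simp only: hecke_right_diff hecke_right_scale hecke_right_quadratic[OF assms]) simp
qed

lemma hecke_right_inv_right:
  assumes "s \<in> S" shows "hecke_right_inv q s (hecke_right q s m) = (\<lambda>x. q * m x)"
  by (simp add: fun_eq_iff hecke_right_inv_def hecke_right_quadratic[OF assms])

text \<open>If \<open>s \<otimes> x = x \<otimes> t\<close>, the two operators coincide at
  \<open>x\<close> and at \<open>x \<otimes> t\<close>. Otherwise neither multiplication affects the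
  descent on the other side, and both composites expand to the same terms.\<close>

lemma hecke_left_right_commute:
  assumes "s \<in> S" "t \<in> S"
  shows "hecke_left q s (hecke_right q t m) = hecke_right q t (hecke_left q s m)"
proof
  fix x
  note [simp] = assms S_carrier[OF assms(1)] S_carrier[OF assms(2)]
  show "hecke_left q s (hecke_right q t m) x = hecke_right q t (hecke_left q s m) x"
  proof (cases "x \<in> carrier W")
    case x [simp]: True
    show ?thesis
    proof (cases "s \<otimes> x = x \<otimes> t")
      case eq: True
      have l: "hecke_left q s n x = hecke_right q t n x" for n :: "'a \<Rightarrow> 'c"
        by (simp add: hecke_left_def hecke_right_def eq)
      have "s \<otimes> (x \<otimes> t) = x" using S_cancel_left[of s x] by (simp add: eq)
      then have l': "hecke_left q s n (x \<otimes> t) = hecke_right q t n (x \<otimes> t)" for n :: "'a \<Rightarrow> 'c"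
        by (simp add: hecke_left_def hecke_right_def S_cancel_right)
      show ?thesis
        unfolding l by (simp only: hecke_right_def[of q t "hecke_right q t m" x]
            hecke_right_def[of q t "hecke_left q s m" x] l l')
    next
      case neq: False
      have "len (s \<otimes> (x \<otimes> t)) < len (x \<otimes> t) \<longleftrightarrow> len (s \<otimes> x) < len x"
        "len (s \<otimes> x \<otimes> t) < len (s \<otimes> x) \<longleftrightarrow> len (x \<otimes> t) < len x"
        using left_descent_mult_right right_descent_mult_left neq by simp_all
      then show ?thesis
        unfolding hecke_left_def hecke_right_def by (simp add: m_assoc algebra_simps)
    qed
  qed (simp add: hecke_left_def hecke_right_def)
qed

lemma hecke_left_right_inv_commute:
  assumes "s \<in> S" "t \<in> S"
  shows "hecke_left q s (hecke_right_inv q t m) = hecke_right_inv q t (hecke_left q s m)"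
proof
  fix x
  have "hecke_left q s (hecke_right_inv q t m) x =
    hecke_left q s (\<lambda>x. hecke_right q t m x - (q - 1) * m x) x"
    by (rule arg_cong[of _ _ "\<lambda>f. hecke_left q s f x"]) (simp add: hecke_right_inv_def fun_eq_iff)
  then show "hecke_left q s (hecke_right_inv q t m) x = hecke_right_inv q t (hecke_left q s m) x"
    by (simp only: hecke_left_diff hecke_left_scale hecke_left_right_commute[OF assms] hecke_right_inv_def)
qed

lemma hecke_left_delta_one:
  assumes "s \<in> S" shows "hecke_left q s (delta \<one>) = hecke_right q s (delta \<one>)"
proof
  fix x
  show "hecke_left q s (delta \<one>) x = hecke_right q s (delta \<one>) x"
  proof (cases "x \<in> carrier W \<and> x \<noteq> \<one> \<and> x \<noteq> s")
    case True
    then have "s \<otimes> x \<noteq> \<one>" "x \<otimes> s \<noteq> \<one>"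
      using assms S_cancel_left[of s x] S_cancel_right[of s x] by (auto simp: S_carrier)
    then show ?thesis using True by (simp add: hecke_left_def hecke_right_def delta_def)
  qed (use assms in \<open>auto simp: hecke_left_def hecke_right_def S_carrier\<close>)
qed

text \<open>At an ascent, \<open>hecke_right q s\<close> sends \<open>delta y\<close> to
  \<open>(q - 1)\<close> times \<open>delta y\<close> plus \<open>delta (y \<otimes> s)\<close>; the
  correction term removes the first summand.\<close>

lemma hecke_right_inv_delta:
  assumes "s \<in> S" "y \<in> carrier W" "len y < len (y \<otimes> s)"
  shows "hecke_right_inv q s (delta y) = delta (y \<otimes> s)"
proof
  fix x
  show "hecke_right_inv q s (delta y) x = delta (y \<otimes> s) x"
  proof (cases "x \<in> carrier W")
    case True
    then have "x \<otimes> s = y \<longleftrightarrow> x = y \<otimes> s"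
      using assms S_cancel_right by auto
    then show ?thesis
      using True assms by (auto simp: hecke_right_inv_def hecke_right_def delta_def S_cancel_right)
  next
    case False
    then show ?thesis using assms by (auto simp: hecke_right_inv_def hecke_right_def delta_def S_carrier)
  qed
qed

section \<open>Products of Hecke operators along words\<close>

lemma fold_hecke_right_commute:
  assumes "set a \<subseteq> S" "s \<in> S"
  shows "fold (hecke_right q) a (hecke_left q s m) = hecke_left q s (fold (hecke_right q) a m)"
  using assms by (induction a arbitrary: m) (auto simp: hecke_left_right_commute[symmetric])

text \<open>On \<open>delta \<one>\<close> left and right operators agree, so the first letter
  becomes a left operator and moves outward past the right operators of the other letters.\<close>

lemma fold_right_eq_foldr_left:
  assumes "set a \<subseteq> S"
  shows "fold (hecke_right q) a (delta \<one>) = foldr (hecke_left q) a (delta \<one>)"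
  using assms
  by (induction a) (auto simp: hecke_left_delta_one[symmetric] fold_hecke_right_commute)

lemma foldr_left_foldr_right_inv_commute:
  assumes "set a \<subseteq> S" "set b \<subseteq> S"
  shows "foldr (hecke_right_inv q) a (foldr (hecke_left q) b m) =
    foldr (hecke_left q) b (foldr (hecke_right_inv q) a m)"
proof -
  have 1: "foldr (hecke_left q) b (hecke_right_inv q s n) = hecke_right_inv q s (foldr (hecke_left q) b n)"
    if "s \<in> S" for s n
    using assms(2) that by (induction b) (auto simp: hecke_left_right_inv_commute)
  show ?thesis using assms(1) by (induction a) (auto simp: 1)
qed

lemma fold_hecke_right_scale:
  "fold (hecke_right q) a (\<lambda>x. c * m x) = (\<lambda>x. c * fold (hecke_right q) a m x)"
  by (induction a arbitrary: m) (auto simp: hecke_right_scale)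

lemma fold_right_foldr_inv:
  assumes "set a \<subseteq> S"
  shows "fold (hecke_right q) a (foldr (hecke_right_inv q) a m) = (\<lambda>x. q ^ length a * m x)"
  using assms
  by (induction a arbitrary: m)
    (auto simp: hecke_right_right_inv fold_hecke_right_scale mult.assoc fun_eq_iff)

lemma hecke_right_inv_scale: "hecke_right_inv q s (\<lambda>x. c * m x) = (\<lambda>x. c * hecke_right_inv q s m x)"
  by (auto simp: hecke_right_inv_def hecke_right_scale fun_eq_iff algebra_simps)

lemma foldr_inv_fold_right:
  assumes "set a \<subseteq> S"
  shows "foldr (hecke_right_inv q) a (fold (hecke_right q) a m) = (\<lambda>x. q ^ length a * m x)"
  using assms
  by (induction a arbitrary: m)
    (auto simp: hecke_right_inv_right hecke_right_inv_scale mult_ac)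

lemma reduced_tl: assumes "reduced (s # a)" shows "reduced a"
proof -
  have S: "s \<in> S" "set a \<subseteq> S" using assms by (auto simp: reduced_def)
  then show ?thesis using assms len_left[of s "val a"] len_le[of a] by (auto simp: reduced_def)
qed

text \<open>\<open>foldr\<close> applies the last letter first, so the delta function travels
  through the inverses of the suffixes; reducedness makes every step an ascent.\<close>

lemma foldr_inv_delta:
  assumes "reduced a"
  shows "foldr (hecke_right_inv q) a (delta \<one>) = delta (inv (val a))"
  using assms
proof (induction a)
  case (Cons s a)
  note red = reduced_tl[OF Cons.prems]
  have S: "s \<in> S" "set a \<subseteq> S" using Cons.prems by (auto simp: reduced_def)
  have e: "inv (val a) \<otimes> s = inv (val (s # a))" using S by (simp add: inv_mult_group S_carrier S_inv)
  have "len (inv (val a)) < len (inv (val a) \<otimes> s)"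
    unfolding e using Cons.prems red S by (subst (1 2) len_inv) (auto simp: reduced_def S_carrier)
  then have "hecke_right_inv q s (delta (inv (val a))) = delta (inv (val (s # a)))"
    unfolding e[symmetric] using S by (intro hecke_right_inv_delta) auto
  then show ?case using Cons.IH[OF red] by simp
qed simp

text \<open>The function of \<open>b\<close> is also a product of left operators applied to the delta function. These
  commute with the inverse right operators along \<open>a\<close>, whose effect on the delta function depends
  only on the value of \<open>a\<close>. So the inverses along \<open>a\<close> act on it as those along \<open>b\<close>.\<close>

lemma fold_right_reduced_unique:
  assumes "reduced a" "reduced b" "val a = val b" "q \<noteq> 0"
  shows "fold (hecke_right q) a (delta \<one>) = fold (hecke_right q) b (delta \<one>)"
proof -
  have S: "set a \<subseteq> S" "set b \<subseteq> S" and len: "length a = length b"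
    using assms by (auto simp: reduced_def)
  let ?M = "\<lambda>a. fold (hecke_right q) a (delta \<one>)"
  have "foldr (hecke_right_inv q) a (?M b) = foldr (hecke_left q) b (delta (inv (val a)))"
    using S assms by (simp only: fold_right_eq_foldr_left foldr_left_foldr_right_inv_commute foldr_inv_delta)
  also have "\<dots> = foldr (hecke_right_inv q) b (?M b)"
    using S assms by (simp only: fold_right_eq_foldr_left foldr_left_foldr_right_inv_commute foldr_inv_delta)
  also have "\<dots> = (\<lambda>x. q ^ length b * delta \<one> x)"
    using foldr_inv_fold_right[OF S(2)] .
  finally have "fold (hecke_right q) a (foldr (hecke_right_inv q) a (?M b)) =
      fold (hecke_right q) a (\<lambda>x. q ^ length b * delta \<one> x)"
    by simp
  then have "(\<lambda>x. q ^ length a * ?M b x) = (\<lambda>x. q ^ length b * ?M a x)"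
    unfolding fold_right_foldr_inv[OF S(1)] fold_hecke_right_scale .
  then show ?thesis using assms(4) len by (simp add: fun_eq_iff)
qed

section \<open>The polynomials as Hecke products\<close>

definition Rpoly :: "'a \<Rightarrow> 'a \<Rightarrow> int poly" where
  "Rpoly u w = (if w \<in> carrier W
     then fold (hecke_right [:0, 1:]) (SOME a. reduced a \<and> val a = w) (delta \<one>) u else 0)"

lemma Rpoly_reduced:
  assumes "reduced a" shows "Rpoly u (val a) = fold (hecke_right [:0, 1:]) a (delta \<one>) u"
proof -
  let ?b = "SOME b. reduced b \<and> val b = val a"
  have "reduced ?b \<and> val ?b = val a" by (rule someI[of _ a]) (use assms in simp)
  then have "fold (hecke_right [:0, 1::int:]) ?b (delta \<one>) = fold (hecke_right [:0, 1:]) a (delta \<one>)"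
    using assms by (intro fold_right_reduced_unique) auto
  then show ?thesis using assms by (simp add: Rpoly_def reduced_def)
qed

lemma Rpoly_right:
  assumes "w \<in> carrier W" "s \<in> S" "len (w \<otimes> s) < len w"
  shows "Rpoly u w = hecke_right [:0, 1:] s (\<lambda>x. Rpoly x (w \<otimes> s)) u"
proof -
  obtain a where a: "reduced a" "val a = w \<otimes> s" using ex_reduced[of "w \<otimes> s"] assms S_carrier by auto
  have v: "val (a @ [s]) = w" using a assms by (simp add: val_append reduced_def S_carrier S_cancel_right)
  have "reduced (a @ [s])" using a v len_right[OF assms(2,1)] assms by (auto simp: reduced_def)
  from Rpoly_reduced[OF this] show ?thesis
    using Rpoly_reduced[OF a(1)] v a(2) by simp
qed

text \<open>Written with left operators, the same product exposes the first letter of a reduced word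
  instead of the last.\<close>

lemma Rpoly_left:
  assumes "w \<in> carrier W" "s \<in> S" "len (s \<otimes> w) < len w"
  shows "Rpoly u w = hecke_left [:0, 1:] s (\<lambda>x. Rpoly x (s \<otimes> w)) u"
proof -
  obtain a where a: "reduced a" "val a = s \<otimes> w" using ex_reduced[of "s \<otimes> w"] assms S_carrier by auto
  have v: "val (s # a) = w" using a assms by (simp add: S_cancel_left)
  have r: "reduced (s # a)" using a v len_left[OF assms(2,1)] assms by (auto simp: reduced_def)
  have "Rpoly x (val a) = foldr (hecke_left [:0, 1:]) a (delta \<one>) x" for x
    using Rpoly_reduced[OF a(1)] a by (simp add: fold_right_eq_foldr_left reduced_def)
  moreover have "Rpoly u (val (s # a)) = foldr (hecke_left [:0, 1:]) (s # a) (delta \<one>) u"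
    using Rpoly_reduced[OF r] r by (simp only: fold_right_eq_foldr_left reduced_def)
  ultimately show ?thesis using v a(2) by (simp del: val_Cons)
qed

lemma Rpoly_one: "Rpoly u \<one> = of_bool (u = \<one>)"
  using Rpoly_reduced[of "[]" u] by (simp add: reduced_def delta_def)

lemma right_descent_induct [consumes 1, case_names one descent]:
  assumes "w \<in> carrier W" "P \<one>"
    and "\<And>w s. w \<in> carrier W \<Longrightarrow> s \<in> S \<Longrightarrow> len (w \<otimes> s) < len w \<Longrightarrow> P (w \<otimes> s) \<Longrightarrow> P w"
  shows "P w"
  using assms(1)
proof (induction "len w" arbitrary: w rule: less_induct)
  case less
  show ?case
  proof (cases "w = \<one>")
    case False
    then obtain s where s: "s \<in> S" "len (w \<otimes> s) < len w" using ex_right_descent less(2) by blast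
    then have "P (w \<otimes> s)" using less(2) S_carrier by (intro less(1)) auto
    then show ?thesis by (rule assms(3)[OF less(2) s])
  qed (use assms(2) in simp)
qed

lemma left_descent_induct [consumes 1, case_names one descent]:
  assumes "w \<in> carrier W" "P \<one>"
    and "\<And>w s. w \<in> carrier W \<Longrightarrow> s \<in> S \<Longrightarrow> len (s \<otimes> w) < len w \<Longrightarrow> P (s \<otimes> w) \<Longrightarrow> P w"
  shows "P w"
  using assms(1)
proof (induction "len w" arbitrary: w rule: less_induct)
  case less
  show ?case
  proof (cases "w = \<one>")
    case False
    then obtain s where s: "s \<in> S" "len (s \<otimes> w) < len w" using ex_left_descent less(2) by blast
    then have "P (s \<otimes> w)" using less(2) S_carrier by (intro less(1)) auto
    then show ?thesis by (rule assms(3)[OF less(2) s])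
  qed (use assms(2) in simp)
qed

section \<open>Existence and uniqueness of the family\<close>

lemma Rpoly_outside: "w \<in> carrier W \<Longrightarrow> u \<notin> carrier W \<Longrightarrow> Rpoly u w = 0"
proof (induction rule: right_descent_induct)
  case one
  then show ?case by (auto simp: Rpoly_one)
next
  case (descent w s)
  then show ?case by (simp add: Rpoly_right[OF descent(1-3)] hecke_right_def)
qed

lemma Rpoly_diag: "w \<in> carrier W \<Longrightarrow> Rpoly w w = 1"
proof (induction rule: right_descent_induct)
  case one
  then show ?case by (simp add: Rpoly_one)
next
  case (descent w s)
  then show ?case by (simp add: Rpoly_right[OF descent(1-3)] hecke_right_def)
qed

text \<open>A nonzero term of the recursion puts \<open>u\<close> or \<open>u \<otimes> s\<close>
  below \<open>w \<otimes> s\<close>. In the second case \<open>ble_mult_right_upper\<close> puts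
  \<open>u\<close> below \<open>w \<otimes> s\<close> or \<open>w\<close>.\<close>

lemma Rpoly_support:
  assumes "w \<in> carrier W" "u \<in> carrier W" "Rpoly u w \<noteq> 0" shows "ble u w"
  using assms
proof (induction arbitrary: u rule: right_descent_induct)
  case one
  then show ?case by (auto simp: Rpoly_one ble_refl)
next
  case (descent w s)
  note c = S_carrier[OF descent(2)]
  note ws = ble_right_descent[OF descent(2,1,3)]
  have "Rpoly u (w \<otimes> s) \<noteq> 0 \<or> Rpoly (u \<otimes> s) (w \<otimes> s) \<noteq> 0"
    using descent.prems Rpoly_right[OF descent(1-3), of u] by (auto simp: hecke_right_def split: if_splits)
  then have "ble u (w \<otimes> s) \<or> ble (u \<otimes> s) (w \<otimes> s)"
    using descent.IH descent.prems(1) c by auto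
  moreover have "ble u w" if "ble (u \<otimes> s) (w \<otimes> s)"
    using ble_mult_right_upper[OF that descent(2)] ble_trans[OF _ ws]
    by (auto simp: S_cancel_right descent(1,2) descent.prems(1))
  ultimately show ?case using ble_trans[OF _ ws] by blast
qed

lemma Rpoly_family: "KL_R_family W S Rpoly"
  unfolding KL_R_family_def
proof (intro conjI allI ballI impI)
  fix u w assume "u \<notin> carrier W \<or> w \<notin> carrier W"
  then show "Rpoly u w = 0" using Rpoly_outside by (cases "w \<in> carrier W") (auto simp: Rpoly_def)
next
  fix u w assume "u \<in> carrier W" "w \<in> carrier W" "\<not> ble u w"
  then show "Rpoly u w = 0" using Rpoly_support by blast
next
  fix u w s assume *: "u \<in> carrier W" "w \<in> carrier W" "s \<in> S" "len (w \<otimes> s) < len w"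
  note rec = Rpoly_right[OF *(2-4), of u] hecke_right_def
  show "Rpoly u w = Rpoly (u \<otimes> s) (w \<otimes> s)" if "len (u \<otimes> s) < len u"
    using * that by (simp only: rec if_True)
  show "Rpoly u w = ([:0, 1:] - 1) * Rpoly u (w \<otimes> s) + [:0, 1:] * Rpoly (u \<otimes> s) (w \<otimes> s)"
    if "len (u \<otimes> s) > len u"
    using * that by (simp add: rec)
qed (simp add: Rpoly_diag)

text \<open>The recursion reduces \<open>w\<close> to \<open>\<one>\<close>, where the support and
  diagonal conditions fix all values.\<close>

lemma KL_R_family_unique:
  assumes "KL_R_family W S R" shows "R = Rpoly"
proof -
  have out: "R u w = 0" if "u \<notin> carrier W \<or> w \<notin> carrier W" for u w
    using assms that unfolding KL_R_family_def by blast
  have supp: "R u w = 0" if "u \<in> carrier W" "w \<in> carrier W" "\<not> ble u w" for u w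
    using assms that unfolding KL_R_family_def by blast
  have diag: "R u u = 1" if "u \<in> carrier W" for u
    using assms that unfolding KL_R_family_def by blast
  have rec1: "R u w = R (u \<otimes> s) (w \<otimes> s)"
    if "u \<in> carrier W" "w \<in> carrier W" "s \<in> S" "len (w \<otimes> s) < len w" "len (u \<otimes> s) < len u" for u w s
    using assms that unfolding KL_R_family_def by blast
  have rec2: "R u w = ([:0, 1:] - 1) * R u (w \<otimes> s) + [:0, 1:] * R (u \<otimes> s) (w \<otimes> s)"
    if "u \<in> carrier W" "w \<in> carrier W" "s \<in> S" "len (w \<otimes> s) < len w" "len u < len (u \<otimes> s)" for u w s
    using assms that unfolding KL_R_family_def by blast
  have "R u w = Rpoly u w" if "w \<in> carrier W" "u \<in> carrier W" for u w
    using that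
  proof (induction arbitrary: u rule: right_descent_induct)
    case one
    then show ?case using supp[of u \<one>] diag[of u] ble_one[of u] by (auto simp: Rpoly_one)
  next
    case (descent w s)
    note IH = descent.IH[of u] descent.IH[of "u \<otimes> s"]
    show ?case
    proof (cases "len (u \<otimes> s) < len u")
      case True
      then show ?thesis
        using rec1[of u w s] IH descent.prems descent(1-3)
        by (simp add: Rpoly_right[OF descent(1-3)] hecke_right_def S_carrier)
    next
      case False
      then have "len u < len (u \<otimes> s)" using len_right[OF descent(2), of u] descent.prems by auto
      then show ?thesis
        using rec2[of u w s] IH descent.prems descent(1-3) False
        by (simp add: Rpoly_right[OF descent(1-3)] hecke_right_def S_carrier)
    qed
  qed
  moreover have "Rpoly u w = 0" if "u \<notin> carrier W \<or> w \<notin> carrier W" for u w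
    using Rpoly_family that unfolding KL_R_family_def by blast
  ultimately show ?thesis using out by (intro ext) metis
qed

lemma KL_R_eq: "KL_R W S = Rpoly"
  unfolding KL_R_def using Rpoly_family KL_R_family_unique by (rule the_equality)

section \<open>Values at 2\<close>

definition Rtwo :: "'a \<Rightarrow> 'a \<Rightarrow> int" where
  "Rtwo u w = poly (Rpoly u w) 2"

lemma Rtwo_right:
  assumes "w \<in> carrier W" "s \<in> S" "len (w \<otimes> s) < len w" "u \<in> carrier W"
  shows "Rtwo u w = (if len (u \<otimes> s) < len u then Rtwo (u \<otimes> s) (w \<otimes> s)
    else Rtwo u (w \<otimes> s) + 2 * Rtwo (u \<otimes> s) (w \<otimes> s))"
  using assms(4) by (simp add: Rtwo_def Rpoly_right[OF assms(1-3)] hecke_right_def)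

lemma Rtwo_left:
  assumes "w \<in> carrier W" "s \<in> S" "len (s \<otimes> w) < len w" "u \<in> carrier W"
  shows "Rtwo u w = (if len (s \<otimes> u) < len u then Rtwo (s \<otimes> u) (s \<otimes> w)
    else Rtwo u (s \<otimes> w) + 2 * Rtwo (s \<otimes> u) (s \<otimes> w))"
  using assms(4) by (simp add: Rtwo_def Rpoly_left[OF assms(1-3)] hecke_left_def)

lemma Rtwo_nonneg: "w \<in> carrier W \<Longrightarrow> u \<in> carrier W \<Longrightarrow> 0 \<le> Rtwo u w"
proof (induction arbitrary: u rule: right_descent_induct)
  case one
  then show ?case by (simp add: Rtwo_def Rpoly_one)
next
  case (descent w s)
  then show ?case by (simp add: Rtwo_right[OF descent(1-3)] S_carrier)
qed

text \<open>The left recursion respects the pair \<open>x\<close>, \<open>x \<otimes> s\<close>: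
  unless \<open>r \<otimes> x = x \<otimes> s\<close>, the generator \<open>r\<close> is a left
  descent of both or of neither and \<open>s\<close> remains an ascent of
  \<open>r \<otimes> x\<close>, so the recursions compare term by term.\<close>

lemma Rtwo_right_ascent_le:
  assumes "w \<in> carrier W" "x \<in> carrier W" "s \<in> S" "len x < len (x \<otimes> s)"
  shows "Rtwo (x \<otimes> s) w \<le> Rtwo x w"
  using assms
proof (induction arbitrary: x rule: left_descent_induct)
  case one
  then have "x \<otimes> s \<noteq> \<one>" by auto
  then show ?case by (simp add: Rtwo_def Rpoly_one)
next
  case (descent w r)
  note [simp] = descent(1,2) descent.prems S_carrier[OF descent(2)] S_carrier[OF descent.prems(2)]
  have rec: "Rtwo u w = (if len (r \<otimes> u) < len u then Rtwo (r \<otimes> u) (r \<otimes> w)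
    else Rtwo u (r \<otimes> w) + 2 * Rtwo (r \<otimes> u) (r \<otimes> w))" if "u \<in> carrier W" for u
    by (rule Rtwo_left) (use descent that in auto)
  show ?case
  proof (cases "r \<otimes> x = x \<otimes> s")
    case True
    \<comment> \<open>Left multiplication by \<open>r\<close> swaps \<open>x\<close> and
      \<open>x \<otimes> s\<close>, so the recursions take different branches and differ by a
      nonnegative term.\<close>
    then have "r \<otimes> (x \<otimes> s) = x" using S_cancel_left[of r x] by simp
    then have "Rtwo (x \<otimes> s) w = Rtwo x (r \<otimes> w)" "Rtwo x w = Rtwo x (r \<otimes> w) + 2 * Rtwo (r \<otimes> x) (r \<otimes> w)"
      using rec[of x] rec[of "x \<otimes> s"] True descent.prems(3) by auto
    then show ?thesis using Rtwo_nonneg[of "r \<otimes> w" "r \<otimes> x"] by simp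
  next
    case False
    have l: "len (r \<otimes> (x \<otimes> s)) < len (x \<otimes> s) \<longleftrightarrow> len (r \<otimes> x) < len x"
      using left_descent_mult_right[OF _ _ _ False] by simp
    have "len (r \<otimes> x) < len (r \<otimes> x \<otimes> s)"
      using right_descent_mult_left[OF _ _ _ False] len_right[of s "r \<otimes> x"] descent.prems(3) by auto
    then have "Rtwo (r \<otimes> x \<otimes> s) (r \<otimes> w) \<le> Rtwo (r \<otimes> x) (r \<otimes> w)"
      using descent.IH[of "r \<otimes> x"] by simp
    moreover have "Rtwo (x \<otimes> s) (r \<otimes> w) \<le> Rtwo x (r \<otimes> w)" using descent.IH[of x] by simp
    ultimately show ?thesis using rec[of x] rec[of "x \<otimes> s"] l by (simp add: m_assoc)
  qed
qed

text \<open>The first argument stays arbitrary in the induction because the recursion also moves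
  it.\<close>

lemma Rtwo_mono:
  assumes "v \<in> carrier W" "x \<in> carrier W" "ble u v"
  shows "Rtwo x u \<le> Rtwo x v"
  using assms
proof (induction arbitrary: x u rule: right_descent_induct)
  case one
  then show ?case using ble_one by auto
next
  case (descent v s)
  note [simp] = descent(1,2) descent.prems(1) S_carrier[OF descent(2)]
  have u [simp]: "u \<in> carrier W" using descent.prems by (simp add: bruhat_le_def)
  note rec = Rtwo_right[OF descent(1-3)]
  show ?case
  proof (cases "len (u \<otimes> s) < len u")
    case True
    \<comment> \<open>Here \<open>s\<close> is a descent of both \<open>u\<close> and
      \<open>v\<close>, so their recursions take the same branch at \<open>x\<close> and compare
      term by term.\<close>
    have "ble (u \<otimes> s) (v \<otimes> s)" by (rule lifting_descent) (use descent True in auto)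
    then have "Rtwo y (u \<otimes> s) \<le> Rtwo y (v \<otimes> s)" if "y \<in> carrier W" for y
      using descent.IH that by blast
    from this[of x] this[of "x \<otimes> s"] show ?thesis
      using rec[of x] Rtwo_right[OF u descent(2) True, of x] by auto
  next
    case False
    then have "ble u (v \<otimes> s)" using lifting_ascent[of u v s] descent len_right[of s u] by auto
    then have le: "Rtwo x u \<le> Rtwo x (v \<otimes> s)" using descent.IH by simp
    show ?thesis
    proof (cases "len (x \<otimes> s) < len x")
      case True
      \<comment> \<open>As \<open>s\<close> is an ascent of \<open>x \<otimes> s\<close>, the
        previous lemma bounds the value at \<open>x\<close> by the one at
        \<open>x \<otimes> s\<close>, which by the recursion is \<open>Rtwo x v\<close>.\<close>
      then have "Rtwo (x \<otimes> s \<otimes> s) (v \<otimes> s) \<le> Rtwo (x \<otimes> s) (v \<otimes> s)"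
        by (intro Rtwo_right_ascent_le) (auto simp: S_cancel_right)
      then show ?thesis using rec[of x] True le by (simp add: S_cancel_right)
    next
      case False
      then show ?thesis using rec[of x] le Rtwo_nonneg[of "v \<otimes> s" "x \<otimes> s"] by simp
    qed
  qed
qed

text \<open>\<open>\<one>\<close> has no descents, so each recursion step only adds an even
  number.\<close>

lemma Rtwo_one_odd: "v \<in> carrier W \<Longrightarrow> odd (Rtwo \<one> v)"
proof (induction rule: right_descent_induct)
  case one
  then show ?case by (simp add: Rtwo_def Rpoly_one)
next
  case (descent v s)
  then show ?case by (simp add: Rtwo_right[OF descent(1-3)])
qed

end

theorem theorem1:
  fixes W :: "('a, 'b) monoid_scheme" and S :: "'a set"
  assumes "coxeter_system W S" and "finite (carrier W)"
  shows "(\<forall>u \<in> carrier W. \<forall>v \<in> carrier W.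
            bruhat_le W S u v \<longrightarrow> bruhat_size W S u \<le> bruhat_size W S v) \<and>
         (\<forall>v \<in> carrier W. odd (bruhat_size W S v))"
proof -
  interpret group W using assms by (simp add: coxeter_system_def)
  interpret coxeter W S by unfold_locales (rule assms)
  have "bruhat_size W S v = Rtwo \<one>\<^bsub>W\<^esub> v" for v
    by (simp add: bruhat_size_def KL_R_eq Rtwo_def)
  then show ?thesis using Rtwo_mono Rtwo_one_odd by simp
qed

end
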